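(* Let $B\in\mathbb{R}_{+}^{n\times n}$ be any matrix with $\mathrm{Tr}(B)\leq 1$ (all matrix operations are in max-algebra), and consider the problem of minimizing $x^{-}\mathbf{1}$ over all regular vectors $x\in\mathbb{R}_{+}^{n}$ subject to $Bx\leq x$ and $\mathbf{1}^{T}x=1$. Then the minimum value of the objective function is equal to $\|B^{\ast}\|$, and the maximal solution of the problem is given by $$x=(\mathbf{1}^{T}B^{\ast})^{-}.$$
   Context: Max-algebra: the set $\mathbb{R}_{+}$ of nonnegative reals with addition $a\oplus b=\max(a,b)$ and the usual multiplication. Matrices and vectors over $\mathbb{R}_+$ are added and multiplied by the usual rules with $+$ replaced by $\oplus$; inequalities are entrywise; $I$ is the usual identity matrix; $B^{0}=I$, $B^{p}=BB^{p-1}$ for integers $p\geq 1$. A vector is regular if it has no zero entries. $\mathbf{1}=(1,\ldots,1)^{T}$. For a nonzero matrix $A=(a_{ij})$, its conjugate $A^{-}=(a^{-}_{ij})$ is the matrix of transposed size with $a^{-}_{ij}=a_{ji}^{-1}$ if $a_{ji}\neq 0$ and $a^{-}_{ij}=0$ otherwise (so the conjugate of a row vector is a column vector and vice versa). $\|A\|=\max_{i,j}a_{ij}$. So $x^{-}\mathbf{1}=\max_i x_i^{-1}$ for regular $x$, and $\mathbf{1}^{T}x=\max_i x_i$. For $B=(b_{ij})\in\mathbb{R}_+^{n\times n}$: $\mathrm{tr}B=\bigoplus_{k=1}^{n}b_{kk}$ and $\mathrm{Tr}(B)=\bigoplus_{k=1}^{n}\mathrm{tr}B^{k}$. If $\mathrm{Tr}(B)\leq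 1$, the Kleene star is $B^{\ast}=\bigoplus_{k=0}^{n-1}B^{k}$. A solution of the problem is a feasible vector attaining the minimum; a solution $x_{0}$ is called maximal if $x_{0}\geq x$ (entrywise) for every solution $x$. *)

theory Defs
  imports "HOL-Analysis.Analysis"
begin

text \<open>
  Max-algebra is the set of nonnegative reals with \<open>max\<close> as addition and the usual
  multiplication. Its matrices and vectors are represented in \<^typ>\<open>real ^ 'n ^ 'm\<close> and
  \<^typ>\<open>real ^ 'n\<close>, and nonnegativity of the entries is stated separately as \<open>0 \<le> A\<close>, the order
  on vectors and matrices being the entrywise one. As in the library's \<open>*v\<close> and \<open>v*\<close>, row and
  column vectors share one type. On vectors \<open>1\<close> is the all-ones vector; the identity matrix is
  \<open>mat 1\<close> (and not \<open>1\<close>, which would be the all-ones matrix).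
\<close>

definition max_mult :: "real ^ 'k ^ 'm \<Rightarrow> real ^ 'n ^ 'k \<Rightarrow> real ^ 'n ^ 'm"
    (infixl "\<otimes>\<^sub>m" 70) where
  "A \<otimes>\<^sub>m B = (\<chi> i j. MAX k. A $ i $ k * B $ k $ j)"

definition max_mult_vec :: "real ^ 'n ^ 'm \<Rightarrow> real ^ 'n \<Rightarrow> real ^ 'm"
    (infixl "\<otimes>\<^sub>m\<^sub>v" 70) where
  "A \<otimes>\<^sub>m\<^sub>v x = (\<chi> i. MAX j. A $ i $ j * x $ j)"

definition vec_max_mult :: "real ^ 'm \<Rightarrow> real ^ 'n ^ 'm \<Rightarrow> real ^ 'n"
    (infixl "\<otimes>\<^sub>v\<^sub>m" 70) where
  "y \<otimes>\<^sub>v\<^sub>m A = (\<chi> j. MAX i. y $ i * A $ i $ j)"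

text \<open>The product of a row vector with a column vector, a scalar.\<close>

definition max_inner :: "real ^ 'n \<Rightarrow> real ^ 'n \<Rightarrow> real" (infixl "\<otimes>\<^sub>v" 70) where
  "y \<otimes>\<^sub>v x = (MAX i. y $ i * x $ i)"

primrec max_power :: "real ^ 'n ^ 'n \<Rightarrow> nat \<Rightarrow> real ^ 'n ^ 'n" where
  "max_power B 0 = mat 1"
| "max_power B (Suc p) = B \<otimes>\<^sub>m max_power B p"

definition max_trace :: "real ^ 'n ^ 'n \<Rightarrow> real" where
  "max_trace B = (MAX k. B $ k $ k)"

definition max_Tr :: "real ^ 'n ^ 'n \<Rightarrow> real" where
  "max_Tr B = (MAX k\<in>{1..CARD('n)}. max_trace (max_power B k))"

text \<open>The star is meaningful when \<open>max_Tr B \<le> 1\<close>.\<close>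

definition kleene_star :: "real ^ 'n ^ 'n \<Rightarrow> real ^ 'n ^ 'n" where
  "kleene_star B = (\<chi> i j. MAX k\<in>{0..CARD('n) - 1}. max_power B k $ i $ j)"

definition max_norm :: "real ^ 'n ^ 'm \<Rightarrow> real" where
  "max_norm A = (MAX (i, j). A $ i $ j)"

text \<open>The conjugate of a row vector is a column vector and vice versa.\<close>

definition conjugate :: "real ^ 'n \<Rightarrow> real ^ 'n" where
  "conjugate x = (\<chi> i. if x $ i \<noteq> 0 then inverse (x $ i) else 0)"

definition regular :: "real ^ 'n \<Rightarrow> bool" where
  "regular x \<longleftrightarrow> (\<forall>i. x $ i \<noteq> 0)"

definition feasible :: "real ^ 'n ^ 'n \<Rightarrow> real ^ 'n \<Rightarrow> bool" where
  "feasible B x \<longleftrightarrow> 0 \<le> x \<and> regular x \<and> B \<otimes>\<^sub>m\<^sub>v x \<le> x \<and> 1 \<otimes>\<^sub>v x = 1"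

definition objective :: "real ^ 'n \<Rightarrow> real" where
  "objective x = conjugate x \<otimes>\<^sub>v 1"

definition solution :: "real ^ 'n ^ 'n \<Rightarrow> real ^ 'n \<Rightarrow> bool" where
  "solution B x \<longleftrightarrow> is_arg_min objective (feasible B) x"

definition maximal_solution :: "real ^ 'n ^ 'n \<Rightarrow> real ^ 'n \<Rightarrow> bool" where
  "maximal_solution B x \<longleftrightarrow> solution B x \<and> (\<forall>y. solution B y \<longrightarrow> y \<le> x)"

end

theory Submission imports Defs begin

text \<open>
  Put \<open>S = B\<^sup>*\<close> and let \<open>c\<^sub>j\<close> be the maximum of column \<open>j\<close> of \<open>S\<close>, so that the vector of the
  theorem is \<open>x\<^sub>j = 1 / c\<^sub>j\<close>. A feasible \<open>y\<close> satisfies \<open>S y \<le> y \<le> 1\<close>, hence \<open>y\<^sub>j \<le> 1 / c\<^sub>j\<close>; thus \<open>x\<close>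
  dominates every feasible vector and the objective is at least \<open>max\<^sub>j c\<^sub>j = \<parallel>S\<parallel>\<close>, the value at \<open>x\<close>.
  It remains to see that \<open>x\<close> is feasible. Since cycles weigh at most 1, cutting them out of walks
  bounds every power of \<open>B\<close> by \<open>S\<close>, so \<open>S B \<le> S\<close> and \<open>S S \<le> S\<close>. The former is \<open>B x \<le> x\<close>. For the
  normalization, choose \<open>i\<close> with \<open>S\<^sub>i\<^sub>j = c\<^sub>j\<close> for some \<open>j\<close>: then \<open>c\<^sub>i c\<^sub>j \<le> c\<^sub>j\<close>, so \<open>c\<^sub>i \<le> 1\<close>.
\<close>

section \<open>Powers and walks\<close>

lemma MAX_finite_attained:
  fixes f :: "'a::finite \<Rightarrow> 'b::linorder"
  obtains i where "(MAX i. f i) = f i"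
  using Max_in[of "range f"] by fastforce

lemma MAX_finite_ge:
  fixes f :: "'a::finite \<Rightarrow> 'b::linorder"
  shows "f i \<le> (MAX i. f i)"
  by simp

lemma MAX_finite_le_iff:
  fixes f :: "'a::finite \<Rightarrow> 'b::linorder"
  shows "(MAX i. f i) \<le> b \<longleftrightarrow> (\<forall>i. f i \<le> b)"
  by (subst Max_le_iff) auto

lemma max_power_Suc_ge: "B $ i $ m * max_power B k $ m $ j \<le> max_power B (Suc k) $ i $ j"
  using MAX_finite_ge[of "\<lambda>m. B $ i $ m * max_power B k $ m $ j" m]
  by (simp add: max_mult_def)

lemma max_power_Suc_attained:
  obtains m where "max_power B (Suc k) $ i $ j = B $ i $ m * max_power B k $ m $ j"
  using MAX_finite_attained[of "\<lambda>m. B $ i $ m * max_power B k $ m $ j"]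
  by (auto simp: max_mult_def)

lemma nonneg_matrix_entry:
  fixes A :: "real ^ 'n ^ 'm"
  assumes "0 \<le> A"
  shows "0 \<le> A $ i $ j"
  using assms by (simp add: less_eq_vec_def)

lemma max_power_nonneg:
  assumes "0 \<le> B"
  shows "0 \<le> max_power B k $ i $ j"
proof (induction k arbitrary: i)
  case 0
  then show ?case by (simp add: mat_def)
next
  case (Suc k)
  obtain m where "max_power B (Suc k) $ i $ j = B $ i $ m * max_power B k $ m $ j"
    by (rule max_power_Suc_attained)
  then show ?case
    using Suc nonneg_matrix_entry[OF assms] by simp
qed

text \<open>Joining a walk of length \<open>a\<close> to one of length \<open>b\<close> gives a walk
  of length \<open>a + b\<close>. Induction peels off the first factor, where the maximum is
  attained.\<close>

lemma max_power_add_ge: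
  assumes "0 \<le> B"
  shows "max_power B a $ i $ m * max_power B b $ m $ j \<le> max_power B (a + b) $ i $ j"
proof (induction a arbitrary: i)
  case 0
  then show ?case
    using max_power_nonneg[OF assms] by (simp add: mat_def)
next
  case (Suc a)
  obtain l where "max_power B (Suc a) $ i $ m = B $ i $ l * max_power B a $ l $ m"
    by (rule max_power_Suc_attained)
  then have "max_power B (Suc a) $ i $ m * max_power B b $ m $ j
      = B $ i $ l * (max_power B a $ l $ m * max_power B b $ m $ j)"
    by simp
  also have "\<dots> \<le> B $ i $ l * max_power B (a + b) $ l $ j"
    by (intro mult_left_mono Suc nonneg_matrix_entry assms)
  also have "\<dots> \<le> max_power B (Suc a + b) $ i $ j"
    using max_power_Suc_ge[of B i l "a + b" j] by simp
  finally show ?case .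
qed

text \<open>Following the index that attains each maximum traces out an optimal walk. The recursion
  ends in \<open>mat 1\<close>, whose off-diagonal zeros belong to no walk; a nonzero entry avoids
  them.\<close>

lemma max_power_walk:
  assumes "max_power B k $ i $ j \<noteq> 0"
  obtains w where "w 0 = i" "w k = j"
    "max_power B k $ i $ j = (\<Prod>l<k. B $ w l $ w (Suc l))"
  using assms
proof (induction k arbitrary: i thesis)
  case 0
  from "0.prems"(2) have "i = j"
    by (simp add: mat_def split: if_splits)
  then show ?case
    using "0.prems"(1)[of "\<lambda>_. j"] by (simp add: mat_def)
next
  case (Suc k)
  obtain m where m: "max_power B (Suc k) $ i $ j = B $ i $ m * max_power B k $ m $ j"
    by (rule max_power_Suc_attained)
  with Suc.prems(2) have "max_power B k $ m $ j \<noteq> 0" by auto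
  then obtain w where w: "w 0 = m" "w k = j"
      "max_power B k $ m $ j = (\<Prod>l<k. B $ w l $ w (Suc l))"
    using Suc.IH by blast
  \<comment> \<open>\<open>case_nat i w\<close> puts the vertex \<open>i\<close> in front of the
    walk \<open>w\<close> and shifts its indices by one.\<close>
  show ?case
    by (rule Suc.prems(1)[of "case_nat i w"])
       (use w m in \<open>simp_all add: prod.lessThan_Suc_shift del: prod.lessThan_Suc max_power.simps\<close>)
qed

text \<open>Converse direction to \<open>max_power_walk\<close>. The offset \<open>a\<close> allows
  it to be applied to any segment of a longer walk.\<close>

lemma walk_weight_le_max_power:
  assumes "0 \<le> B"
  shows "(\<Prod>l\<in>{a..<a + k}. B $ w l $ w (Suc l)) \<le> max_power B k $ w a $ w (a + k)"
proof (induction k arbitrary: a)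
  case 0
  then show ?case by (simp add: mat_def)
next
  case (Suc k)
  have "(\<Prod>l\<in>{a..<a + Suc k}. B $ w l $ w (Suc l))
      = B $ w a $ w (Suc a) * (\<Prod>l\<in>{Suc a..<Suc a + k}. B $ w l $ w (Suc l))"
    by (subst prod.atLeast_Suc_lessThan) simp_all
  also have "\<dots> \<le> B $ w a $ w (Suc a) * max_power B k $ w (Suc a) $ w (Suc a + k)"
    by (intro mult_left_mono Suc nonneg_matrix_entry assms)
  also have "\<dots> \<le> max_power B (Suc k) $ w a $ w (a + Suc k)"
    using max_power_Suc_ge[of B "w a" "w (Suc a)" k "w (Suc a + k)"] by simp
  finally show ?case .
qed

section \<open>The Kleene star\<close>

lemma max_power_diag_le_Tr:
  fixes B :: "real ^ 'n ^ 'n"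
  assumes "1 \<le> k" "k \<le> CARD('n)"
  shows "max_power B k $ i $ i \<le> max_Tr B"
proof -
  have "max_power B k $ i $ i \<le> max_trace (max_power B k)"
    by (simp add: max_trace_def)
  also have "\<dots> \<le> max_Tr B"
    unfolding max_Tr_def using assms by (intro Max_ge) auto
  finally show ?thesis .
qed

lemma max_power_le_star_lt:
  fixes B :: "real ^ 'n ^ 'n"
  assumes "k < CARD('n)"
  shows "max_power B k $ i $ j \<le> kleene_star B $ i $ j"
  unfolding kleene_star_def using assms by (auto intro!: Max_ge)

lemma kleene_star_attained:
  fixes B :: "real ^ 'n ^ 'n"
  obtains k where "kleene_star B $ i $ j = max_power B k $ i $ j"
proof -
  let ?f = "\<lambda>k. max_power B k $ i $ j"
  have "Max (?f ` {0..CARD('n) - 1}) \<in> ?f ` {0..CARD('n) - 1}"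
    by (intro Max_in) auto
  then obtain k where "Max (?f ` {0..CARD('n) - 1}) = ?f k"
    by blast
  then show ?thesis
    using that[of k] by (simp add: kleene_star_def)
qed

lemma kleene_star_nonneg:
  assumes "0 \<le> B"
  shows "0 \<le> kleene_star B $ i $ j"
proof -
  obtain k where "kleene_star B $ i $ j = max_power B k $ i $ j"
    by (rule kleene_star_attained)
  then show ?thesis using max_power_nonneg[OF assms] by simp
qed

lemma kleene_star_diag_ge_1: "1 \<le> kleene_star B $ i $ i"
  using max_power_le_star_lt[of 0 B i i] by (simp add: mat_def)

lemma max_power_le_star:
  fixes B :: "real ^ 'n ^ 'n"
  assumes B: "0 \<le> B" and Tr: "max_Tr B \<le> 1"
  shows "max_power B k $ i $ j \<le> kleene_star B $ i $ j"
proof (induction k rule: less_induct)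
  case (less k)
  consider "k < CARD('n)" | "max_power B k $ i $ j = 0"
    | "CARD('n) \<le> k" "max_power B k $ i $ j \<noteq> 0"
    by linarith
  then show ?case
  proof cases
    case 1
    then show ?thesis by (rule max_power_le_star_lt)
  next
    case 2
    then show ?thesis using kleene_star_nonneg[OF B] by simp
  next
    case 3
    obtain w where w: "w 0 = i" "w k = j"
        "max_power B k $ i $ j = (\<Prod>l<k. B $ w l $ w (Suc l))"
      using max_power_walk[OF 3(2)] by blast
    \<comment> \<open>Pigeonhole on the first \<open>CARD('n) + 1\<close> vertices only, so that the
      cycle found has length at most \<open>CARD('n)\<close> and is covered by
      \<open>max_Tr\<close>.\<close>
    have "\<not> inj_on w {0..CARD('n)}"
      using card_inj_on_le[of w "{0..CARD('n)}" UNIV] by auto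
    then obtain a b where ab: "a < b" "b \<le> CARD('n)" "w a = w b"
      unfolding inj_on_def by (metis atLeastAtMost_iff linorder_neqE_nat)
    define W where "W c d = (\<Prod>l\<in>{c..<d}. B $ w l $ w (Suc l))" for c d
    have W_ge: "0 \<le> W c d" for c d
      unfolding W_def by (intro prod_nonneg nonneg_matrix_entry[OF B] ballI)
    have W_le: "W c d \<le> max_power B (d - c) $ w c $ w d" if "c \<le> d" for c d
      using walk_weight_le_max_power[OF B, of w c "d - c"] that by (simp add: W_def)
    have cyc: "W a b \<le> 1"
    proof -
      have "W a b \<le> max_power B (b - a) $ w a $ w a"
        using W_le[of a b] ab by simp
      also have "\<dots> \<le> max_Tr B"
        using ab by (intro max_power_diag_le_Tr) auto
      finally show ?thesis using Tr by linarith
    qed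
    have "max_power B k $ i $ j = W 0 a * W a b * W b k"
      using w(3) ab 3(1)
      by (simp add: W_def prod.atLeastLessThan_concat lessThan_atLeast0)
    also have "\<dots> \<le> W 0 a * 1 * W b k"
      by (intro mult_right_mono mult_left_mono W_ge cyc)
    also have "\<dots> \<le> max_power B a $ i $ w a * max_power B (k - b) $ w a $ j"
      using W_le[of 0 a] W_le[of b k] ab 3(1) w W_ge max_power_nonneg[OF B]
      by (auto intro!: mult_mono)
    also have "\<dots> \<le> max_power B (a + (k - b)) $ i $ j"
      by (rule max_power_add_ge[OF B])
    \<comment> \<open>The cycle has positive length, so \<open>a + (k - b) < k\<close> and the
      induction hypothesis applies.\<close>
    also have "\<dots> \<le> kleene_star B $ i $ j"
      using ab 3(1) by (intro less) auto
    finally show ?thesis .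
  qed
qed

text \<open>The exponents of the two factors may add up to more than \<open>CARD('n) - 1\<close>;
  \<open>max_power_le_star\<close> bounds such powers too.\<close>

lemma kleene_star_mult_le:
  assumes "0 \<le> B" "max_Tr B \<le> 1"
  shows "kleene_star B $ i $ m * kleene_star B $ m $ j \<le> kleene_star B $ i $ j"
proof -
  obtain a where a: "kleene_star B $ i $ m = max_power B a $ i $ m"
    by (rule kleene_star_attained)
  obtain b where b: "kleene_star B $ m $ j = max_power B b $ m $ j"
    by (rule kleene_star_attained)
  show ?thesis
    unfolding a b by (rule order_trans[OF max_power_add_ge max_power_le_star]) (fact assms)+
qed

text \<open>The first power of \<open>B\<close> is \<open>B\<close>. In dimension 1 the star is just
  \<open>mat 1\<close>, and the bound then rests on \<open>max_Tr B \<le> 1\<close>.\<close>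

lemma le_kleene_star:
  fixes B :: "real ^ 'n ^ 'n"
  assumes "0 \<le> B" "max_Tr B \<le> 1"
  shows "B $ i $ j \<le> kleene_star B $ i $ j"
  using max_power_Suc_ge[of B i j 0 j] max_power_le_star[OF assms, of 1 i j]
  by (simp add: mat_def)

text \<open>Iterating \<open>B x \<le> x\<close> bounds the product of every power of
  \<open>B\<close> with \<open>x\<close> by \<open>x\<close>, and each entry of the star is an entry
  of some power.\<close>

lemma kleene_star_mult_vec_le:
  assumes B: "0 \<le> B" and x0: "0 \<le> x" and x: "B \<otimes>\<^sub>m\<^sub>v x \<le> x"
  shows "kleene_star B $ i $ j * x $ j \<le> x $ i"
proof -
  have step: "B $ i $ m * x $ m \<le> x $ i" for i m
    using x MAX_finite_ge[of "\<lambda>m. B $ i $ m * x $ m" m]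
    by (simp add: less_eq_vec_def max_mult_vec_def)
  have "max_power B k $ i $ j * x $ j \<le> x $ i" for k
  proof (induction k arbitrary: i)
    case 0
    then show ?case using x0 by (simp add: mat_def less_eq_vec_def)
  next
    case (Suc k)
    obtain l where "max_power B (Suc k) $ i $ j = B $ i $ l * max_power B k $ l $ j"
      by (rule max_power_Suc_attained)
    then have "max_power B (Suc k) $ i $ j * x $ j
        = B $ i $ l * (max_power B k $ l $ j * x $ j)"
      by simp
    also have "\<dots> \<le> B $ i $ l * x $ l"
      by (intro mult_left_mono Suc nonneg_matrix_entry B)
    also have "\<dots> \<le> x $ i" by (rule step)
    finally show ?case .
  qed
  moreover obtain k where "kleene_star B $ i $ j = max_power B k $ i $ j"
    by (rule kleene_star_attained)
  ultimately show ?thesis by simp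
qed

section \<open>The optimization problem\<close>

lemma max_norm_le_iff: "max_norm A \<le> b \<longleftrightarrow> (\<forall>i j. A $ i $ j \<le> b)"
  by (simp add: max_norm_def MAX_finite_le_iff)

lemma feasible_pos:
  assumes "feasible B x"
  shows "0 < x $ i"
  using assms by (auto simp: feasible_def regular_def less_eq_vec_def less_le)

lemma feasible_le_1:
  assumes "feasible B x"
  shows "x $ i \<le> 1"
  using assms MAX_finite_ge[of "\<lambda>i. x $ i" i] by (simp add: feasible_def max_inner_def)

lemma objective_feasible:
  assumes "feasible B x"
  shows "objective x = (MAX i. inverse (x $ i))"
  using assms by (simp add: objective_def conjugate_def max_inner_def feasible_def regular_def)

lemma kleene_star_le_inverse_feasible:
  assumes "0 \<le> B" "feasible B x"
  shows "kleene_star B $ i $ j \<le> inverse (x $ j)"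
proof -
  have "kleene_star B $ i $ j * x $ j \<le> x $ i"
    using assms by (intro kleene_star_mult_vec_le) (auto simp: feasible_def)
  also have "\<dots> \<le> 1" by (rule feasible_le_1[OF assms(2)])
  finally show ?thesis
    using feasible_pos[OF assms(2), of j] by (simp add: field_simps)
qed

lemma max_norm_star_le_objective:
  assumes "0 \<le> B" "feasible B x"
  shows "max_norm (kleene_star B) \<le> objective x"
  unfolding max_norm_le_iff objective_feasible[OF assms(2)]
  using kleene_star_le_inverse_feasible[OF assms] MAX_finite_ge[of "\<lambda>i. inverse (x $ i)"]
  by (meson order_trans)

theorem lemma8:
  fixes B :: "real ^ 'n ^ 'n"
  assumes "0 \<le> B"
    and "max_Tr B \<le> 1"
  shows "(\<exists>x. feasible B x \<and> objective x = max_norm (kleene_star B))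
       \<and> (\<forall>x. feasible B x \<longrightarrow> max_norm (kleene_star B) \<le> objective x)
       \<and> maximal_solution B (conjugate (1 \<otimes>\<^sub>v\<^sub>m kleene_star B))"
proof -
  define S where "S = kleene_star B"
  define c where "c j = (MAX i. S $ i $ j)" for j
  define x where "x = conjugate (1 \<otimes>\<^sub>v\<^sub>m kleene_star B)"
  have S_le_c: "S $ i $ j \<le> c j" for i j
    by (simp add: c_def)
  have c_attained: "\<exists>i. c j = S $ i $ j" for j
    unfolding c_def using MAX_finite_attained[of "\<lambda>i. S $ i $ j"] by metis
  have c_ge_1: "1 \<le> c j" for j
    using S_le_c[of j j] kleene_star_diag_ge_1[of B j] by (simp add: S_def)
  have c_nz: "c j \<noteq> 0" for j
    using c_ge_1[of j] by linarith
  have x: "x $ j = inverse (c j)" for j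
    using c_nz[of j] by (simp add: x_def conjugate_def vec_max_mult_def c_def S_def)

  have "B \<otimes>\<^sub>m\<^sub>v x \<le> x"
    unfolding less_eq_vec_def max_mult_vec_def
  proof (simp add: MAX_finite_le_iff, intro allI)
    fix i j
    obtain k where k: "c i = S $ k $ i" using c_attained by blast
    \<comment> \<open>With \<open>x\<close> the vector of inverses of \<open>c\<close>, the goal
      amounts to \<open>c i * B $ i $ j \<le> c j\<close>.\<close>
    have "c i * B $ i $ j \<le> S $ k $ i * S $ i $ j"
      using le_kleene_star[OF assms, of i j] c_ge_1[of i] unfolding k S_def
      by (intro mult_left_mono) auto
    also have "\<dots> \<le> S $ k $ j"
      unfolding S_def by (rule kleene_star_mult_le[OF assms])
    also have "\<dots> \<le> c j" by (rule S_le_c)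
    finally show "B $ i $ j * x $ j \<le> x $ i"
      using c_ge_1[of i] c_ge_1[of j] by (simp add: x field_simps)
  qed
  moreover have "1 \<otimes>\<^sub>v x = 1"
  proof -
    \<comment> \<open>Any column \<open>j\<close> will do: the row \<open>i\<close> attaining its
      maximum satisfies \<open>c i = 1\<close>, hence \<open>x $ i = 1\<close>.\<close>
    fix j :: 'n
    obtain i where i: "c j = S $ i $ j" using c_attained by blast
    obtain k where k: "c i = S $ k $ i" using c_attained by blast
    have "c i * c j \<le> c j"
      using kleene_star_mult_le[OF assms, of k i j] S_le_c[of k j]
      unfolding i k by (simp add: S_def i)
    then have "c i = 1"
      using c_ge_1[of i] c_ge_1[of j] by simp
    then have "1 \<le> (MAX i. x $ i)"
      using MAX_finite_ge[of "\<lambda>i. x $ i" i] by (simp add: x)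
    moreover have "(MAX i. x $ i) \<le> 1"
      unfolding MAX_finite_le_iff using c_ge_1 by (simp add: x inverse_le_1_iff)
    ultimately have "(MAX i. x $ i) = 1" by (rule order_antisym[rotated])
    then show ?thesis by (simp add: max_inner_def)
  qed
  moreover have "0 \<le> x" "regular x"
    using c_ge_1 c_nz by (auto simp: less_eq_vec_def regular_def x intro: order_trans[of 0 1])
  ultimately have feas: "feasible B x"
    by (simp add: feasible_def)
  \<comment> \<open>Each \<open>inverse (x $ i)\<close> is \<open>c i\<close>, which is itself an
    entry of \<open>S\<close>.\<close>
  have "objective x \<le> max_norm S"
    unfolding objective_feasible[OF feas] MAX_finite_le_iff
    using c_attained max_norm_le_iff[of S "max_norm S"] by (simp add: x) metis
  then have obj: "objective x = max_norm S"
    using max_norm_star_le_objective[OF assms(1) feas] by (simp add: S_def)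
  have "y \<le> x" if "feasible B y" for y
    unfolding less_eq_vec_def
  proof
    fix j
    have "c j \<le> inverse (y $ j)"
      using kleene_star_le_inverse_feasible[OF assms(1) that] c_attained[of j]
      by (auto simp: S_def)
    then have "inverse (inverse (y $ j)) \<le> inverse (c j)"
      using c_ge_1[of j] by (intro le_imp_inverse_le) auto
    then show "y $ j \<le> x $ j" by (simp add: x)
  qed
  then have "maximal_solution B x"
    using feas obj max_norm_star_le_objective[OF assms(1)]
    by (auto simp: maximal_solution_def solution_def is_arg_min_def S_def not_less)
  then show ?thesis
    using feas obj max_norm_star_le_objective[OF assms(1)] by (auto simp: S_def x_def)
qed

end
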